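(* Let $G$ be a connected graph of order $n$. Then $mvd(G)=n$ if and only if every block of $G$ is a complete graph.
   Context: A block of $G$ is a maximal connected subgraph of $G$ that has no cut-vertex. For a vertex-colored graph and two nonadjacent vertices $x,y$, an $x$-$y$ vertex cut is a set $S\subseteq V(G)\setminus\{x,y\}$ such that $x$ and $y$ lie in different components of $G-S$; it is monochromatic if all its vertices have the same color. A vertex-coloring is an MVD-coloring if every pair of nonadjacent vertices has a monochromatic vertex cut separating them. $mvd(G)$ is the maximum number of colors used by an MVD-coloring of $G$. *)

theory Defs
  imports "Graph_Theory.Graph_Theory" "Graph_Theory.Kuratowski"
begin

text \<open>
  Finite simple undirected graphs are the locale \<^locale>\<open>graph\<close>: finite symmetric digraphs
  without loops and parallel arcs, each edge being represented by its two opposite arcs. In a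
  symmetric digraph the connected components are the strongly connected ones.
\<close>

abbreviation components :: "('a, 'b) pre_digraph \<Rightarrow> ('a, 'b) pre_digraph set" where
  "components G \<equiv> pre_digraph.sccs G"

definition cut_vertex :: "('a, 'b) pre_digraph \<Rightarrow> 'a \<Rightarrow> bool" where
  "cut_vertex G v \<longleftrightarrow>
     v \<in> verts G \<and> card (components (pre_digraph.del_vert G v)) > card (components G)"

text \<open>
  A library subgraph of a symmetric digraph need not be symmetric, so \<^term>\<open>graph K\<close> restricts
  both the block and its competitors to undirected subgraphs. Cut-vertices are those of the
  subgraph itself, not of the ambient graph.
\<close>

definition block :: "('a, 'b) pre_digraph \<Rightarrow> ('a, 'b) pre_digraph \<Rightarrow> bool" where
  "block G H \<longleftrightarrow>
     pre_digraph.max_subgraph G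
       (\<lambda>K. graph K \<and> Digraph_Component.connected K \<and> (\<nexists>v. cut_vertex K v)) H"

definition vertex_cut :: "('a, 'b) pre_digraph \<Rightarrow> 'a \<Rightarrow> 'a \<Rightarrow> 'a set \<Rightarrow> bool" where
  "vertex_cut G x y S \<longleftrightarrow>
     S \<subseteq> verts G - {x, y} \<and>
     (\<exists>C \<in> components (G \<restriction> (verts G - S)). \<exists>D \<in> components (G \<restriction> (verts G - S)).
        x \<in> verts C \<and> y \<in> verts D \<and> C \<noteq> D)"

definition monochromatic :: "('a \<Rightarrow> nat) \<Rightarrow> 'a set \<Rightarrow> bool" where
  "monochromatic c S \<longleftrightarrow> (\<forall>u \<in> S. \<forall>v \<in> S. c u = c v)"

definition mvd_coloring :: "('a, 'b) pre_digraph \<Rightarrow> ('a \<Rightarrow> nat) \<Rightarrow> bool" where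
  "mvd_coloring G c \<longleftrightarrow>
     (\<forall>x \<in> verts G. \<forall>y \<in> verts G. x \<noteq> y \<and> \<not> x \<rightarrow>\<^bsub>G\<^esub> y \<longrightarrow>
        (\<exists>S. vertex_cut G x y S \<and> monochromatic c S))"

text \<open>
  For a finite graph this maximum is over a finite nonempty set of numbers: a constant coloring
  is an MVD-coloring, with the cut consisting of all vertices other than the two given ones.
\<close>

definition mvd :: "('a, 'b) pre_digraph \<Rightarrow> nat" where
  "mvd G = Max {card (c ` verts G) | c. mvd_coloring G c}"

end

theory Submission
  imports Defs
begin

text \<open>
  Since \<open>mvd G = n\<close> forces an injective coloring, it says that any two nonadjacent vertices are
  separated by at most one vertex. If a block contained two nonadjacent vertices, no single vertex
  could separate them, because a block stays connected after deleting any vertex. Conversely, let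
  all blocks be complete and \<open>x\<close>, \<open>y\<close> be nonadjacent. Some path from \<open>x\<close> to \<open>y\<close> leaves the closed
  neighbourhood of \<open>x\<close> for good along an edge \<open>v w\<close>. Then \<open>v\<close> separates \<open>x\<close> from \<open>y\<close>: otherwise
  \<open>x v w\<close> extends to a cycle, which lies in a block, so that \<open>x\<close> and \<open>w\<close> would be adjacent.
\<close>

section \<open>Reachability and components\<close>

lemma dominates_induce_iff:
  "u \<rightarrow>\<^bsub>G \<restriction> S\<^esub> v \<longleftrightarrow> u \<rightarrow>\<^bsub>G\<^esub> v \<and> u \<in> S \<and> v \<in> S"
  by (auto simp: arcs_ends_conv)

lemma subgraph_induce_mono:
  assumes "subgraph H G" "S \<subseteq> T"
  shows "subgraph (H \<restriction> S) (G \<restriction> T)"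
proof (rule subgraphI)
  have "compatible G H" "arcs H \<subseteq> arcs G" using assms(1) by auto
  then show "arcs (H \<restriction> S) \<subseteq> arcs (G \<restriction> T)" "compatible (G \<restriction> T) (H \<restriction> S)"
    using assms(2) by (auto simp: compatible_def)
  show "wf_digraph (H \<restriction> S)" "wf_digraph (G \<restriction> T)"
    using assms(1) by (auto intro: wf_digraph.wellformed_induce_subgraph)
qed (use assms(2) in simp)

lemma (in graph) graph_induce:
  assumes "S \<subseteq> verts G"
  shows "graph (G \<restriction> S)"
proof -
  have "induced_subgraph (G \<restriction> S) G" using assms by (rule induced_induce)
  then show ?thesis
    using digraph.graphI[OF digraphI_induced induced_graph_imp_symmetric[OF sym_arcs]] by blast
qed

lemma (in wf_digraph) del_vert_eq_induce:
  "del_vert v = G \<restriction> (verts G - {v})"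
  by (rule pre_digraph.equality) (auto simp: del_vert_simps)

lemma (in sym_digraph) connected_iff_reachable:
  "Digraph_Component.connected G \<longleftrightarrow> verts G \<noteq> {} \<and> (\<forall>u\<in>verts G. \<forall>v\<in>verts G. u \<rightarrow>\<^sup>* v)"
  unfolding connected_def strongly_connected_def
  by (simp add: reachable_mk_symmetric_eq[OF sym_arcs])

text \<open>Components are the reachability classes, and two different ones are disjoint. This turns
  statements about components, in vertex cuts as well as in cut-vertices, into statements about
  reachability.\<close>

lemma (in sym_digraph) distinct_components_iff:
  "(\<exists>C\<in>sccs. \<exists>D\<in>sccs. x \<in> verts C \<and> y \<in> verts D \<and> C \<noteq> D)
     \<longleftrightarrow> x \<in> verts G \<and> y \<in> verts G \<and> \<not> x \<rightarrow>\<^sup>* y" (is "?L \<longleftrightarrow> ?R")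
proof
  assume ?L
  then obtain C D where CD: "C \<in> sccs" "D \<in> sccs" "x \<in> verts C" "y \<in> verts D" "C \<noteq> D" by blast
  have C: "verts C \<in> sccs_verts" and D: "verts D \<in> sccs_verts"
    using CD by (auto intro: in_sccs_vertsI_sccs)
  have "y \<notin> verts C" using scc_disj[OF CD(1,2,5)] CD by auto
  then have "\<not> x \<rightarrow>\<^sup>* y"
    using C CD(3) unfolding in_sccs_verts_conv_reachable by (blast intro: symmetric_reachable')
  then show ?R using sccs_verts_subsets[OF C] sccs_verts_subsets[OF D] CD by auto
next
  assume R: ?R
  let ?C = "G \<restriction> {v. x \<rightarrow>\<^sup>* v}" and ?D = "G \<restriction> {v. y \<rightarrow>\<^sup>* v}"
  have "?C \<in> sccs" "?D \<in> sccs" using R by (auto intro: induce_reachable_is_in_sccs)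
  moreover have "x \<in> verts ?C" "y \<in> verts ?D" "y \<notin> verts ?C" using R by auto
  ultimately show ?L by metis
qed

lemma (in graph) vertex_cut_iff:
  "vertex_cut G x y S \<longleftrightarrow>
     S \<subseteq> verts G - {x, y} \<and> x \<in> verts G \<and> y \<in> verts G \<and> \<not> x \<rightarrow>\<^sup>*\<^bsub>G \<restriction> (verts G - S)\<^esub> y"
proof -
  interpret K: graph "G \<restriction> (verts G - S)" by (rule graph_induce) auto
  show ?thesis unfolding vertex_cut_def K.distinct_components_iff by auto
qed

section \<open>Cut-vertices and blocks\<close>

text \<open>A connected graph has exactly one component, so deleting \<open>v\<close> raises the
  number exactly when at least two components remain. If nothing remains, there are none, so the
  vertex of a one-vertex graph is not a cut-vertex.\<close>

lemma (in graph) cut_vertex_iff_separates: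
  assumes "Digraph_Component.connected G"
  shows "cut_vertex G v \<longleftrightarrow> v \<in> verts G \<and>
    (\<exists>x \<in> verts G - {v}. \<exists>y \<in> verts G - {v}. \<not> x \<rightarrow>\<^sup>*\<^bsub>G \<restriction> (verts G - {v})\<^esub> y)"
proof -
  let ?K = "G \<restriction> (verts G - {v})"
  interpret K: graph ?K by (rule graph_induce) auto
  have "strongly_connected G"
    using assms by (rule symmetric_connected_imp_strongly_connected[OF sym_arcs])
  then have "card sccs = 1" by (simp add: strongly_connected_eq_iff)
  moreover have "card K.sccs > 1 \<longleftrightarrow> (\<exists>x \<in> verts ?K. \<exists>y \<in> verts ?K. \<not> x \<rightarrow>\<^sup>*\<^bsub>?K\<^esub> y)"
  proof -
    have fin: "finite K.sccs"
      using K.finite_sccs_verts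
      by (metis K.inj_on_verts_sccs K.in_sccs_vertsI_sccs finite_imageD finite_subset subsetI)
    have "card K.sccs > 1 \<longleftrightarrow> (\<exists>C\<in>K.sccs. \<exists>D\<in>K.sccs. C \<noteq> D)"
      using card_le_Suc0_iff_eq[OF fin] by (auto simp: not_le[symmetric])
    also have "\<dots> \<longleftrightarrow> (\<exists>x y. \<exists>C\<in>K.sccs. \<exists>D\<in>K.sccs. x \<in> verts C \<and> y \<in> verts D \<and> C \<noteq> D)"
    proof -
      \<comment> \<open>Nonempty components supply the vertices \<open>x\<close> and
        \<open>y\<close> that represent \<open>C\<close> and \<open>D\<close>.\<close>
      have "verts C \<noteq> {}" if "C \<in> K.sccs" for C
        using that by (auto simp: K.sccs_def strongly_connected_def)
      then show ?thesis by (metis ex_in_conv)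
    qed
    finally show ?thesis unfolding K.distinct_components_iff by blast
  qed
  ultimately show ?thesis
    unfolding cut_vertex_def del_vert_eq_induce by simp
qed

text \<open>By finiteness, some candidate between \<open>K\<close> and \<open>G\<close> has the
  greatest number of vertices plus arcs. It is maximal among all candidates, since every candidate
  above it also contains \<open>K\<close>.\<close>

lemma (in graph) ex_block_superset:
  assumes "subgraph K G" "graph K" "Digraph_Component.connected K" "\<nexists>v. cut_vertex K v"
  obtains H where "block G H" "subgraph K H"
proof -
  let ?Q = "\<lambda>H. graph H \<and> Digraph_Component.connected H \<and> (\<nexists>v. cut_vertex H v)"
  let ?P = "\<lambda>H. subgraph K H \<and> subgraph H G \<and> ?Q H"
  let ?size = "\<lambda>H :: ('a, 'b) pre_digraph. card (verts H) + card (arcs H)"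
  have "?P K" using assms by (auto intro: wf_digraph.subgraph_refl)
  moreover have "\<forall>H. ?P H \<longrightarrow> ?size H < Suc (?size G)"
    by (auto simp: less_Suc_eq_le subgraph_def intro!: add_mono card_mono)
  ultimately obtain H where H: "?P H" and max: "\<And>H'. ?P H' \<Longrightarrow> ?size H' \<le> ?size H"
    using ex_has_greatest_nat[of ?P K ?size "Suc (?size G)"] by blast
  have "H' = H" if H': "subgraph H H'" "subgraph H' G" "?Q H'" for H'
  proof -
    interpret H': graph H' using H' by simp
    have le: "?size H' \<le> ?size H" using H H' max subgraph_trans by blast
    have sub: "verts H \<subseteq> verts H'" "arcs H \<subseteq> arcs H'" using H' by auto
    then have "card (verts H) \<le> card (verts H')" "card (arcs H) \<le> card (arcs H')"
      by (auto intro: card_mono)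
    then have "card (verts H) = card (verts H')" "card (arcs H) = card (arcs H')"
      using le by linarith+
    then have "verts H = verts H'" "arcs H = arcs H'"
      using sub by (simp_all add: card_subset_eq)
    \<comment> \<open>A digraph also consists of its tail and head functions; compatibility makes
      these agree.\<close>
    then show ?thesis using H' by (auto simp: subgraph_def compatible_def)
  qed
  then have "block G H" using H unfolding block_def max_subgraph_def by blast
  with H that show thesis by blast
qed

text \<open>Adding all arcs of \<open>G\<close> between vertices of \<open>H\<close> can destroy
  neither connectedness nor the absence of cut-vertices, so maximality leaves nothing to add. Thus
  vertices nonadjacent in a block are nonadjacent in \<open>G\<close>.\<close>

lemma (in graph) block_is_induced:
  assumes "block G H"
  shows "H = G \<restriction> verts H"
proof -
  let ?K = "G \<restriction> verts H"
  have H: "subgraph H G" "graph H" "Digraph_Component.connected H" "\<nexists>v. cut_vertex H v"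
    using assms unfolding block_def max_subgraph_def by auto
  interpret H: graph H by fact
  have sub: "verts H \<subseteq> verts G" using H by auto
  interpret K: graph ?K using sub by (rule graph_induce)
  have HK: "subgraph H ?K" using H(1) by (rule subgraph_induce_subgraphI2)
  have conn: "Digraph_Component.connected ?K"
    using H(3) HK unfolding H.connected_iff_reachable K.connected_iff_reachable
    by (auto intro: K.reachable_mono)
  have "\<not> cut_vertex ?K v" for v
  proof
    assume "cut_vertex ?K v"
    then obtain x y where v: "v \<in> verts H"
      and xy: "x \<in> verts H - {v}" "y \<in> verts H - {v}"
      and nr: "\<not> x \<rightarrow>\<^sup>*\<^bsub>?K \<restriction> (verts H - {v})\<^esub> y"
      unfolding K.cut_vertex_iff_separates[OF conn] by auto
    have "x \<rightarrow>\<^sup>*\<^bsub>H \<restriction> (verts H - {v})\<^esub> y"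
      using H(4) xy v unfolding H.cut_vertex_iff_separates[OF H(3)] by blast
    moreover have "subgraph (H \<restriction> (verts H - {v})) (?K \<restriction> (verts H - {v}))"
      using HK by (rule subgraph_induce_mono) simp
    ultimately have "x \<rightarrow>\<^sup>*\<^bsub>?K \<restriction> (verts H - {v})\<^esub> y" by (rule pre_digraph.reachable_mono)
    with nr show False ..
  qed
  moreover have "subgraph ?K G" using sub by (rule subgraph_induce_subgraphI)
  moreover have "\<not> (subgraph H' G \<and> graph H' \<and> Digraph_Component.connected H' \<and> (\<nexists>v. cut_vertex H' v))"
    if "H' \<noteq> H" "subgraph H H'" for H'
    using assms that unfolding block_def max_subgraph_def by blast
  ultimately show ?thesis using HK conn K.graph_axioms by metis
qed

section \<open>Separating nonadjacent vertices by one vertex\<close>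

lemma (in graph) block_not_separated_by_vertex:
  assumes "block G H" "x \<in> verts H" "y \<in> verts H" "s \<noteq> x" "s \<noteq> y"
  shows "x \<rightarrow>\<^sup>*\<^bsub>G \<restriction> (verts G - {s})\<^esub> y"
proof -
  have H: "subgraph H G" "graph H" "Digraph_Component.connected H" "\<nexists>v. cut_vertex H v"
    using assms(1) unfolding block_def max_subgraph_def by auto
  interpret H: graph H by fact
  have sub: "subgraph (H \<restriction> (verts H - {s})) (G \<restriction> (verts G - {s}))"
    using H(1) by (rule subgraph_induce_mono) (use H(1) in auto)
  \<comment> \<open>For \<open>s\<close> in \<open>H\<close> this holds because \<open>s\<close> is
    not a cut-vertex of \<open>H\<close>; for \<open>s\<close> outside, nothing is deleted from
    \<open>H\<close>.\<close>
  have "x \<rightarrow>\<^sup>*\<^bsub>H \<restriction> (verts H - {s})\<^esub> y"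
  proof (cases "s \<in> verts H")
    case True
    then show ?thesis
      using H(4) assms unfolding H.cut_vertex_iff_separates[OF H(3)] by blast
  next
    case False
    then have "H \<restriction> (verts H - {s}) = H" by (intro pre_digraph.equality) auto
    then show ?thesis using H(3) assms unfolding H.connected_iff_reachable by simp
  qed
  then show ?thesis using sub by (rule pre_digraph.reachable_mono)
qed

text \<open>Deleting \<open>w\<close> breaks a path into at most two pieces, each of which still
  contains an end of the path. This is what makes a cycle survive the deletion of a vertex.\<close>

lemma (in sym_digraph) reachable_end_of_apath:
  assumes "apath a p b" "u \<in> set (awalk_verts a p)" "u \<noteq> w"
    and "set (awalk_verts a p) \<subseteq> S"
  shows "u \<rightarrow>\<^sup>*\<^bsub>G \<restriction> (S - {w})\<^esub> a \<or> u \<rightarrow>\<^sup>*\<^bsub>G \<restriction> (S - {w})\<^esub> b"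
  using assms
proof (induction p arbitrary: a)
  case Nil
  interpret K: wf_digraph "G \<restriction> (S - {w})" by auto
  show ?case using Nil by (auto simp: apath_Nil_iff)
next
  case (Cons e p)
  let ?K = "G \<restriction> (S - {w})" and ?c = "head G e"
  interpret K: wf_digraph ?K by auto
  have e: "e \<in> arcs G" "tail G e = a" and p: "apath ?c p b"
    and a: "a \<notin> set (awalk_verts ?c p)" and sub: "set (awalk_verts ?c p) \<subseteq> S" "a \<in> S"
    using Cons.prems by (auto simp: apath_Cons_iff)
  have c: "?c \<in> set (awalk_verts ?c p)"
    using p by (auto simp: apath_def intro: hd_in_awalk_verts)
  have "?c \<rightarrow>\<^bsub>G\<^esub> a" using e by (metis graph_symmetric in_arcs_imp_in_arcs_ends)
  show ?case
  proof (cases "u = a")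
    case True
    then show ?thesis using Cons.prems sub by auto
  next
    case False
    then have u: "u \<in> set (awalk_verts ?c p)" using Cons.prems e by simp
    show ?thesis
    proof (cases "w = a")
      case True
      \<comment> \<open>A path does not repeat its first vertex, so the rest of it avoids
        \<open>w\<close> and leads from \<open>u\<close> to \<open>b\<close>.\<close>
      have "K.awalk ?c p b"
        using p a sub True by (intro awalk_induce) (auto simp: apath_def)
      then show ?thesis
        using u K.awalk_verts_reachable_to by (auto simp: awalk_verts_induce)
    next
      case False
      consider "u \<rightarrow>\<^sup>*\<^bsub>?K\<^esub> ?c" | "u \<rightarrow>\<^sup>*\<^bsub>?K\<^esub> b"
        using Cons.IH[OF p u Cons.prems(3) sub(1)] by blast
      then show ?thesis
      proof cases
        case 1
        have "?c \<in> S - {w}" using K.reachable_in_verts(2)[OF 1] by simp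
        then have "?c \<rightarrow>\<^bsub>?K\<^esub> a"
          using \<open>?c \<rightarrow>\<^bsub>G\<^esub> a\<close> sub False by (auto simp: dominates_induce_iff)
        with 1 show ?thesis by (blast intro: K.reachable_adj_trans)
      qed simp
    qed
  qed
qed

text \<open>A path from \<open>a\<close> to \<open>b\<close> that avoids \<open>v\<close> closes
  through \<open>v\<close> to a cycle, or to a single edge if \<open>a = b\<close>. The graph
  induced on its vertices is connected without cut-vertex and hence lies in a block.\<close>

lemma (in graph) ex_block_of_cycle:
  assumes "a \<rightarrow>\<^bsub>G\<^esub> v" "v \<rightarrow>\<^bsub>G\<^esub> b" "a \<rightarrow>\<^sup>*\<^bsub>G \<restriction> (verts G - {v})\<^esub> b"
  obtains H where "block G H" "a \<in> verts H" "b \<in> verts H"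
proof -
  let ?G' = "G \<restriction> (verts G - {v})"
  interpret G': graph ?G' by (rule graph_induce) auto
  obtain p where p: "G'.apath a p b" using assms(3) unfolding G'.reachable_apath by blast
  define P where "P = set (G'.awalk_verts a p)"
  have awalk: "G'.awalk a p b" using p by (rule G'.awalkI_apath)
  have P: "P \<subseteq> verts G - {v}" "a \<in> P" "b \<in> P"
  proof -
    show "P \<subseteq> verts G - {v}"
      using G'.awalk_verts_reachable_to[OF awalk] G'.reachable_in_verts(1)
      unfolding P_def by (metis induce_subgraph_verts subsetI)
    show "a \<in> P" unfolding P_def using awalk by (rule G'.hd_in_awalk_verts)
    show "b \<in> P"
      using awalk last_in_set[OF G'.awalk_verts_non_Nil[of a p]] unfolding P_def G'.awalk_conv by simp
  qed
  have "v \<in> verts G" using assms adj_in_verts by blast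
  let ?C = "insert v P"
  have C: "?C \<subseteq> verts G" using P \<open>v \<in> verts G\<close> by auto
  interpret C: graph "G \<restriction> ?C" using C by (rule graph_induce)
  have reach_P: "x \<rightarrow>\<^sup>*\<^bsub>G \<restriction> P\<^esub> b" if "x \<in> P" for x
  proof -
    interpret Q: wf_digraph "?G' \<restriction> P" by auto
    have "Q.awalk a p b"
      using awalk by (rule G'.awalk_induce) (simp add: P_def)
    then have "x \<rightarrow>\<^sup>*\<^bsub>?G' \<restriction> P\<^esub> b"
      using that Q.awalk_verts_reachable_to by (auto simp: G'.awalk_verts_induce P_def)
    moreover have "?G' \<restriction> P = G \<restriction> P" using P by (intro pre_digraph.equality) auto
    ultimately show ?thesis by simp
  qed
  have deleted: "x \<rightarrow>\<^sup>*\<^bsub>G \<restriction> (?C - {w})\<^esub> y" if xy: "x \<in> ?C - {w}" "y \<in> ?C - {w}" for x y w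
  proof -
    let ?K = "G \<restriction> (?C - {w})"
    interpret K: graph ?K using C by (intro graph_induce) auto
    show ?thesis
    \<comment> \<open>Without \<open>v\<close> the path \<open>P\<close> remains, and all its
      vertices reach \<open>b\<close>. If \<open>v\<close> remains, it serves as a hub: each vertex
      of the broken path reaches \<open>a\<close> or \<open>b\<close>, and both are adjacent to
      \<open>v\<close>.\<close>
    proof (cases "w = v")
      case True
      then have "?C - {w} = P" using P by auto
      then show ?thesis
        using xy reach_P K.symmetric_reachable' K.reachable_trans by metis
    next
      case False
      have "x \<rightarrow>\<^sup>*\<^bsub>?K\<^esub> v" if x: "x \<in> ?C - {w}" for x
      proof (cases "x = v")
        case True
        then show ?thesis using x by auto
      next
        case False
        have sub: "subgraph (?G' \<restriction> (P - {w})) ?K" 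
          by (rule subgraph_induce_mono[OF subgraph_induce_subgraphI]) auto
        have "x \<rightarrow>\<^sup>*\<^bsub>?G' \<restriction> (P - {w})\<^esub> a \<or> x \<rightarrow>\<^sup>*\<^bsub>?G' \<restriction> (P - {w})\<^esub> b"
          using G'.reachable_end_of_apath[OF p] x False unfolding P_def by auto
        then obtain c where c: "c = a \<or> c = b" and "x \<rightarrow>\<^sup>*\<^bsub>?K\<^esub> c"
          using sub K.reachable_mono by blast
        moreover have "c \<rightarrow>\<^bsub>?K\<^esub> v"
          using c assms(1,2) graph_symmetric \<open>w \<noteq> v\<close> K.reachable_in_verts[OF \<open>x \<rightarrow>\<^sup>*\<^bsub>?K\<^esub> c\<close>]
          by (auto simp: dominates_induce_iff)
        ultimately show ?thesis by (blast intro: K.reachable_adj_trans)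
      qed
      then show ?thesis using xy K.symmetric_reachable' K.reachable_trans by metis
    qed
  qed
  have reach_v: "x \<rightarrow>\<^sup>*\<^bsub>G \<restriction> ?C\<^esub> v" if "x \<in> ?C" for x
  proof (cases "x = v")
    case False
    then have "x \<rightarrow>\<^sup>*\<^bsub>G \<restriction> ?C\<^esub> b"
      using reach_P that reachable_induce_ss by blast
    moreover have "b \<rightarrow>\<^bsub>G \<restriction> ?C\<^esub> v"
      using assms(2) graph_symmetric P by (auto simp: dominates_induce_iff)
    ultimately show ?thesis by (rule C.reachable_adj_trans)
  qed auto
  have conn: "Digraph_Component.connected (G \<restriction> ?C)"
    unfolding C.connected_iff_reachable
    using reach_v C.symmetric_reachable' C.reachable_trans by (metis induce_subgraph_verts insert_not_empty)
  have eq: "(G \<restriction> ?C) \<restriction> (?C - {w}) = G \<restriction> (?C - {w})" for w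
    by (intro pre_digraph.equality) auto
  have "\<nexists>w. cut_vertex (G \<restriction> ?C) w"
    unfolding C.cut_vertex_iff_separates[OF conn] using deleted by (simp add: eq)
  then obtain H where H: "block G H" "subgraph (G \<restriction> ?C) H"
    using ex_block_superset subgraph_induce_subgraphI[OF C] C.graph_axioms conn by blast
  then have "?C \<subseteq> verts H" by (metis induce_subgraph_verts subgraph_imp_subverts)
  with H P that show thesis by blast
qed

text \<open>Take the edge along which a walk from \<open>x\<close> to \<open>y\<close> leaves
  \<open>A\<close> for the last time; the remainder of the walk stays outside
  \<open>A\<close>.\<close>

lemma (in wf_digraph) reachable_last_exit:
  assumes "x \<rightarrow>\<^sup>* y" "x \<in> A" "y \<notin> A"
  obtains v w where "v \<in> A" "w \<notin> A" "v \<rightarrow>\<^bsub>G\<^esub> w" "w \<rightarrow>\<^sup>*\<^bsub>G \<restriction> (verts G - A)\<^esub> y"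
proof -
  let ?K = "G \<restriction> (verts G - A)"
  interpret K: wf_digraph ?K by auto
  have "(x \<notin> A \<and> x \<rightarrow>\<^sup>*\<^bsub>?K\<^esub> y) \<or> (\<exists>v w. v \<in> A \<and> w \<notin> A \<and> v \<rightarrow>\<^bsub>G\<^esub> w \<and> w \<rightarrow>\<^sup>*\<^bsub>?K\<^esub> y)"
    using assms(1)
  \<comment> \<open>The induction prepends edges to a walk ending in \<open>y\<close>. The first
    disjunct says that no vertex of \<open>A\<close> has been met yet; the first one met gives the
    exit edge.\<close>
  proof induct
    case base
    then show ?case using assms(3) by auto
  next
    case (step u u')
    then show ?case
      by (metis DiffI K.adj_reachable_trans adj_in_verts dominates_induce_iff)
  qed
  with assms(2) that show thesis by blast
qed

lemma (in graph) ex_separating_vertex: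
  assumes "\<And>H. block G H \<Longrightarrow> \<exists>m. complete_digraph m H"
    and "x \<rightarrow>\<^sup>* y" "x \<noteq> y" "\<not> x \<rightarrow>\<^bsub>G\<^esub> y"
  obtains v where "v \<in> verts G" "v \<noteq> x" "v \<noteq> y" "\<not> x \<rightarrow>\<^sup>*\<^bsub>G \<restriction> (verts G - {v})\<^esub> y"
proof -
  define A where "A = insert x {u. x \<rightarrow>\<^bsub>G\<^esub> u}"
  have "x \<in> A" "y \<notin> A" using assms by (auto simp: A_def)
  then obtain v w where vw: "v \<in> A" "w \<notin> A" "v \<rightarrow>\<^bsub>G\<^esub> w" "w \<rightarrow>\<^sup>*\<^bsub>G \<restriction> (verts G - A)\<^esub> y"
    using reachable_last_exit[OF assms(2)] by blast
  \<comment> \<open>All neighbours of \<open>x\<close> lie in \<open>A\<close>, but \<open>w\<close>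
    does not.\<close>
  have "v \<noteq> x" using vw by (auto simp: A_def)
  then have "x \<rightarrow>\<^bsub>G\<^esub> v" using vw by (auto simp: A_def)
  have "v \<in> verts G" "v \<noteq> y" using vw adj_in_verts \<open>y \<notin> A\<close> by auto
  let ?K = "G \<restriction> (verts G - {v})"
  interpret K: graph ?K by (rule graph_induce) auto
  have "\<not> x \<rightarrow>\<^sup>*\<^bsub>?K\<^esub> y"
  proof
    assume "x \<rightarrow>\<^sup>*\<^bsub>?K\<^esub> y"
    \<comment> \<open>The walk from \<open>w\<close> to \<open>y\<close> avoids all of
      \<open>A\<close>, in particular \<open>v\<close>. Joined with the assumed walk from
      \<open>x\<close> to \<open>y\<close>, it gives the detour around \<open>v\<close> that closes
      the cycle.\<close>
    moreover have "w \<rightarrow>\<^sup>*\<^bsub>?K\<^esub> y" using vw by (auto intro: reachable_induce_ss)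
    ultimately have "x \<rightarrow>\<^sup>*\<^bsub>?K\<^esub> w" by (metis K.symmetric_reachable' K.reachable_trans)
    then obtain H where H: "block G H" "x \<in> verts H" "w \<in> verts H"
      using ex_block_of_cycle \<open>x \<rightarrow>\<^bsub>G\<^esub> v\<close> \<open>v \<rightarrow>\<^bsub>G\<^esub> w\<close> by blast
    have "x \<noteq> w" using vw by (auto simp: A_def)
    then have "x \<rightarrow>\<^bsub>H\<^esub> w" using assms(1)[OF H(1)] H by (auto simp: complete_digraph_def)
    then have "x \<rightarrow>\<^bsub>G\<^esub> w"
      using H(1) adj_mono unfolding block_def max_subgraph_def by blast
    then show False using vw by (simp add: A_def)
  qed
  with \<open>v \<in> verts G\<close> \<open>v \<noteq> x\<close> \<open>v \<noteq> y\<close> that show thesis by blast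
qed

section \<open>Injective colorings\<close>

text \<open>Deleting everything except two nonadjacent vertices isolates them, and any set is
  monochromatic here. Hence the maximum in \<open>mvd\<close> is over a nonempty set.\<close>

lemma (in graph) mvd_coloring_const: "mvd_coloring G (\<lambda>_. k)"
  unfolding mvd_coloring_def
proof (intro ballI impI)
  fix x y assume xy: "x \<in> verts G" "y \<in> verts G" "x \<noteq> y \<and> \<not> x \<rightarrow>\<^bsub>G\<^esub> y"
  let ?S = "verts G - {x, y}"
  have eq: "verts G - ?S = {x, y}" using xy by auto
  have "\<not> x \<rightarrow>\<^sup>*\<^bsub>G \<restriction> {x, y}\<^esub> y"
  proof
    assume "x \<rightarrow>\<^sup>*\<^bsub>G \<restriction> {x, y}\<^esub> y"
    then obtain u where "x \<rightarrow>\<^bsub>G \<restriction> {x, y}\<^esub> u"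
      using xy by (auto elim: pre_digraph.converse_reachable_cases)
    then show False using xy adj_not_same by (auto simp: dominates_induce_iff)
  qed
  then have "vertex_cut G x y ?S" unfolding vertex_cut_iff eq using xy by simp
  then show "\<exists>S. vertex_cut G x y S \<and> monochromatic (\<lambda>_. k) S"
    unfolding monochromatic_def by blast
qed

text \<open>The maximum is attained and no coloring uses more colors than there are vertices;
  equality means that no color is repeated.\<close>

lemma (in graph) mvd_eq_card_iff:
  "mvd G = card (verts G) \<longleftrightarrow> (\<exists>c. mvd_coloring G c \<and> inj_on c (verts G))"
proof -
  let ?M = "{card (c ` verts G) | c. mvd_coloring G c}"
  have le: "m \<le> card (verts G)" if "m \<in> ?M" for m
    using that by (auto intro: card_image_le)
  then have fin: "finite ?M" by (meson finite_nat_set_iff_bounded_le)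
  have ne: "?M \<noteq> {}" using mvd_coloring_const by blast
  have "mvd G = card (verts G) \<longleftrightarrow> card (verts G) \<in> ?M"
    unfolding mvd_def using fin ne le by (metis (no_types, lifting) Max_eqI Max_in)
  also have "\<dots> \<longleftrightarrow> (\<exists>c. mvd_coloring G c \<and> inj_on c (verts G))"
    by (auto simp: inj_on_iff_eq_card) metis
  finally show ?thesis .
qed

text \<open>Under an injective coloring a monochromatic set has at most one vertex, and the empty
  set separates nothing in a connected graph. The resulting condition no longer mentions
  \<open>c\<close>.\<close>

lemma (in graph) mvd_coloring_inj_iff:
  assumes "Digraph_Component.connected G" "inj_on c (verts G)"
  shows "mvd_coloring G c \<longleftrightarrow>
    (\<forall>x\<in>verts G. \<forall>y\<in>verts G. x \<noteq> y \<and> \<not> x \<rightarrow>\<^bsub>G\<^esub> y \<longrightarrow>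
      (\<exists>s\<in>verts G - {x, y}. \<not> x \<rightarrow>\<^sup>*\<^bsub>G \<restriction> (verts G - {s})\<^esub> y))"
proof -
  have "(\<exists>S. vertex_cut G x y S \<and> monochromatic c S) \<longleftrightarrow>
      (\<exists>s\<in>verts G - {x, y}. \<not> x \<rightarrow>\<^sup>*\<^bsub>G \<restriction> (verts G - {s})\<^esub> y)" (is "?L \<longleftrightarrow> ?R")
    if xy: "x \<in> verts G" "y \<in> verts G" for x y
  proof
    assume ?L
    then obtain S where S: "S \<subseteq> verts G - {x, y}" "\<not> x \<rightarrow>\<^sup>*\<^bsub>G \<restriction> (verts G - S)\<^esub> y"
      and mono: "monochromatic c S"
      by (auto simp: vertex_cut_iff)
    have "G \<restriction> verts G = G" by (intro pre_digraph.equality) auto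
    then have "S \<noteq> {}" using S(2) assms(1) xy by (auto simp: connected_iff_reachable)
    then obtain s where s: "s \<in> S" by auto
    have "S \<subseteq> {s}"
      using mono s S(1) inj_on_eq_iff[OF assms(2)] unfolding monochromatic_def by blast
    with s have "S = {s}" by auto
    with S show ?R by auto
  next
    assume ?R
    then obtain s where "s \<in> verts G - {x, y}" "\<not> x \<rightarrow>\<^sup>*\<^bsub>G \<restriction> (verts G - {s})\<^esub> y" by blast
    then have "vertex_cut G x y {s}" "monochromatic c {s}"
      using xy by (auto simp: vertex_cut_iff monochromatic_def)
    then show ?L by blast
  qed
  then show ?thesis unfolding mvd_coloring_def by simp
qed

theorem theorem3p3:
  fixes G :: "('a, 'b) pre_digraph" and n :: nat
  assumes "graph G"
    and "Digraph_Component.connected G"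
    and "card (verts G) = n"
  shows "mvd G = n \<longleftrightarrow> (\<forall>H. block G H \<longrightarrow> (\<exists>m. complete_digraph m H))"
proof -
  interpret graph G by fact
  obtain c :: "'a \<Rightarrow> nat" where c: "inj_on c (verts G)"
    using finite_verts finite_imp_inj_to_nat_seg by metis
  let ?sep = "\<forall>x\<in>verts G. \<forall>y\<in>verts G. x \<noteq> y \<and> \<not> x \<rightarrow>\<^bsub>G\<^esub> y \<longrightarrow>
      (\<exists>s\<in>verts G - {x, y}. \<not> x \<rightarrow>\<^sup>*\<^bsub>G \<restriction> (verts G - {s})\<^esub> y)"
  \<comment> \<open>Since \<open>?sep\<close> does not depend on the coloring, one injective
    coloring is an MVD-coloring exactly when all are; finiteness of \<open>G\<close> provides
    one.\<close>
  have "mvd G = n \<longleftrightarrow> ?sep"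
    using mvd_eq_card_iff mvd_coloring_inj_iff[OF assms(2)] c assms(3) by metis
  also have "\<dots> \<longleftrightarrow> (\<forall>H. block G H \<longrightarrow> (\<exists>m. complete_digraph m H))"
  proof (intro iffI allI impI)
    fix H assume sep: ?sep and H: "block G H"
    have gH: "graph H" "subgraph H G"
      using H unfolding block_def max_subgraph_def by auto
    interpret H: graph H by fact
    have "x \<rightarrow>\<^bsub>H\<^esub> y" if xy: "x \<in> verts H" "y \<in> verts H" "x \<noteq> y" for x y
    proof (rule ccontr)
      assume "\<not> x \<rightarrow>\<^bsub>H\<^esub> y"
      then have "\<not> x \<rightarrow>\<^bsub>G\<^esub> y"
        using block_is_induced[OF H] xy dominates_induce_iff by metis
      moreover have "x \<in> verts G" "y \<in> verts G" using xy gH by auto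
      ultimately obtain s where "s \<noteq> x" "s \<noteq> y" "\<not> x \<rightarrow>\<^sup>*\<^bsub>G \<restriction> (verts G - {s})\<^esub> y"
        using sep xy by auto
      then show False using block_not_separated_by_vertex[OF H] xy by blast
    qed
    \<comment> \<open>The converse inclusion holds because arcs join vertices of \<open>H\<close>
      and there are no loops.\<close>
    then have "arcs_ends H = {(u, v). (u, v) \<in> verts H \<times> verts H \<and> u \<noteq> v}"
      by (auto dest: H.adj_in_verts H.adj_not_same)
    then show "\<exists>m. complete_digraph m H" using gH by (auto simp: complete_digraph_def)
  next
    assume blocks: "\<forall>H. block G H \<longrightarrow> (\<exists>m. complete_digraph m H)"
    show ?sep
    proof (intro ballI impI)
      fix x y assume xy: "x \<in> verts G" "y \<in> verts G" "x \<noteq> y \<and> \<not> x \<rightarrow>\<^bsub>G\<^esub> y"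
      then have "x \<rightarrow>\<^sup>*\<^bsub>G\<^esub> y" using assms(2) unfolding connected_iff_reachable by blast
      then show "\<exists>s\<in>verts G - {x, y}. \<not> x \<rightarrow>\<^sup>*\<^bsub>G \<restriction> (verts G - {s})\<^esub> y"
        using ex_separating_vertex[of x y] blocks xy by (metis DiffI empty_iff insert_iff)
    qed
  qed
  finally show ?thesis .
qed

end
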